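(* Let $m\geqslant 2$, let $\mu\subseteq\lambda$ be partitions and $1\leqslant k<m$. For every $T\in\mathsf{SVT}^m(\lambda/\mu)$ we have $\mathsf{res}(f_k(T))=f^\star_k(\mathsf{res}(T))$ and $\mathsf{res}(e_k(T))=e^\star_k(\mathsf{res}(T))$, with the convention $\mathsf{res}(0)=0$ (so in particular $f_k(T)=0$ if and only if $f^\star_k(\mathsf{res}(T))=0$, and similarly for $e_k$).
   Context: Tableaux are in French notation; cell $(i,j)$ lies in row $i$ (from the bottom) and column $j$. $\mathsf{SVT}^m(\lambda/\mu)$ is the set of fillings of the cells of $\lambda/\mu$ by nonempty subsets of $[m]$ with $\max(A)\leqslant\min(B)$ for horizontally adjacent cells $A$ left of $B$ and $\max(A)<\min(C)$ for vertically adjacent cells $A$ below $C$. Crystal on $\mathsf{SVT}^m(\lambda/\mu)$: assign $-$ to each column containing $k$ but not $k+1$, and $+$ to each column containing $k+1$ but not $k$; successively pair each $+$ with an adjacent $-$ to its right (ignoring paired signs) until no more pairs form. If no unpaired $-$ exists, $f_k(T)=0$; else let $b$ be the cell with the $k$ in the rightmost column carrying an unpaired $-$; if the cell $b^\rightarrow$ right of $b$ contains both $k$ and $k+1$, remove $k$ from $b^\rightarrow$ and add $k+1$ to $b$, otherwise change that $k$ in $b$ into $k+1$. If no unpaired $+$ exists, $e_k(T)=0$; else let $b$ be the cell with the $k+1$ in the leftmost column carrying an unpaired $+$; if the cell $b^\leftarrow$ left of $b$ contains both $k$ and $k+1$, remove $k+1$ from $b^\leftarrow$ and add $k$ to $b$,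 otherwise change that $k+1$ into $k$. Residue map: the content of cell $(i,j)$ of $\lambda/\mu$ is $\ell(\lambda)+j-i$ ($\ell(\lambda)$ = number of parts); $\mathsf{res}(T)=h^m\cdots h^1$ where $h^a$ is the decreasing list of contents of the cells containing $a$. Its image lies in $\mathcal{H}^{m,\star}$: the set of decreasing factorizations $h^m\cdots h^1$ (each $h^a$ a possibly empty strictly decreasing word of positive integers) whose product is fully-commutative in the 0-Hecke monoid (words modulo $pq=qp$ for $|p-q|>1$, $pqp=qpq$, $pp=p$; fully-commutative means no equivalent reduced word contains $i(i+1)i$ or $i(i-1)i$ consecutively). $\star$-crystal on $\mathcal{H}^{m,\star}$: pair letters $b$ of $h^{k+1}$, in decreasing order, each with the smallest not-yet-paired letter $a\geqslant b$ of $h^k$ if one exists. If all letters of $h^k$ are paired, $f^\star_k=0$; else with $x$ the largest unpaired letter of $h^k$: if $x+1\in h^k\cap h^{k+1}$, remove $x+1$ from $h^k$ and add $x$ to $h^{k+1}$; otherwise move $x$ from $h^k$ to $h^{k+1}$. If all letters of $h^{k+1}$ are paired, $e^\star_k=0$; else with $y$ the smallest unpaired letter of $h^{k+1}$: if $y-1\in h^k\cap h^{k+1}$, remove $y-1$ from $h^{k+1}$ and add $y$ to $h^k$; otherwise move $y$ from $h^{k+1}$ to $h^k$. *)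

theory Defs
  imports Main
begin

definition is_partition :: "nat list \<Rightarrow> bool" where
  "is_partition lam \<longleftrightarrow> sorted_wrt (\<ge>) lam \<and> 0 \<notin> set lam"

definition part :: "nat list \<Rightarrow> nat \<Rightarrow> nat" where
  "part lam i = (if 1 \<le> i \<and> i \<le> length lam then lam ! (i - 1) else 0)"

definition partition_le :: "nat list \<Rightarrow> nat list \<Rightarrow> bool" where
  "partition_le mu lam \<longleftrightarrow> (\<forall>i. part mu i \<le> part lam i)"

definition skew_cells :: "nat list \<Rightarrow> nat list \<Rightarrow> (nat \<times> nat) set" where
  "skew_cells lam mu = {(i, j). 1 \<le> i \<and> part mu i < j \<and> j \<le> part lam i}"

text \<open>
  A filling is a function on all pairs (row, column), rows counted from the bottom (French
  notation); it takes the value \<open>{}\<close> outside the shape, so that the neighbouring cells inspected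
  by the crystal operators contain nothing when they lie outside the shape.
\<close>

type_synonym filling = "nat \<times> nat \<Rightarrow> nat set"

definition SVT :: "nat \<Rightarrow> nat list \<Rightarrow> nat list \<Rightarrow> filling set" where
  "SVT m lam mu = {T.
     (\<forall>c \<in> skew_cells lam mu. T c \<noteq> {} \<and> T c \<subseteq> {1..m}) \<and>
     (\<forall>c. c \<notin> skew_cells lam mu \<longrightarrow> T c = {}) \<and>
     (\<forall>i j. (i, j) \<in> skew_cells lam mu \<and> (i, j + 1) \<in> skew_cells lam mu
        \<longrightarrow> Max (T (i, j)) \<le> Min (T (i, j + 1))) \<and>
     (\<forall>i j. (i, j) \<in> skew_cells lam mu \<and> (i + 1, j) \<in> skew_cells lam mu
        \<longrightarrow> Max (T (i, j)) < Min (T (i + 1, j)))}"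


subsection \<open>Crystal operators on set-valued tableaux\<close>

datatype sign = Plus | Minus

definition in_column :: "filling \<Rightarrow> nat \<Rightarrow> nat \<Rightarrow> bool" where
  "in_column T j a \<longleftrightarrow> (\<exists>i. a \<in> T (i, j))"

definition column_sign :: "filling \<Rightarrow> nat \<Rightarrow> nat \<Rightarrow> (sign \<times> nat) option" where
  "column_sign T k j =
     (if in_column T j k \<and> \<not> in_column T j (k + 1) then Some (Minus, j)
      else if in_column T j (k + 1) \<and> \<not> in_column T j k then Some (Plus, j)
      else None)"

definition signature :: "nat list \<Rightarrow> nat \<Rightarrow> filling \<Rightarrow> (sign \<times> nat) list" where
  "signature lam k T = List.map_filter (column_sign T k) [1..<part lam 1 + 1]"

inductive pair_step :: "(sign \<times> nat) list \<Rightarrow> (sign \<times> nat) list \<Rightarrow> bool" where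
  "pair_step (u @ (Plus, c) # (Minus, d) # v) (u @ v)"

text \<open>
  The signs left over after successively pairing each \<open>+\<close> with an adjacent \<open>-\<close> to its right.
  By lemma \<open>unpaired_iff\<close> below this is the unique outcome of carrying out
  \<open>pair_step\<close>s, in any order, until none is possible.
\<close>

fun unpaired :: "(sign \<times> nat) list \<Rightarrow> (sign \<times> nat) list" where
  "unpaired [] = []"
| "unpaired (x # w) =
     (case unpaired w of
        [] \<Rightarrow> [x]
      | y # v \<Rightarrow> if fst x = Plus \<and> fst y = Minus then v else x # y # v)"

lemma pair_step_Cons: "pair_step w w' \<Longrightarrow> pair_step (x # w) (x # w')"
  by (induction rule: pair_step.induct) (metis append_Cons pair_step.intros)

lemma pair_steps_Cons: "pair_step\<^sup>*\<^sup>* w w' \<Longrightarrow> pair_step\<^sup>*\<^sup>* (x # w) (x # w')"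
  by (induction rule: rtranclp_induct) (auto intro: pair_step_Cons rtranclp.rtrancl_into_rtrancl)

lemma unpaired_reachable: "pair_step\<^sup>*\<^sup>* w (unpaired w)"
proof (induction w)
  case Nil
  then show ?case by simp
next
  case (Cons x w)
  note steps = pair_steps_Cons[OF Cons, of x]
  show ?case
  proof (cases "unpaired w")
    case Nil
    then show ?thesis using steps by simp
  next
    case (Cons y v)
    have "pair_step (x # y # v) v" if "fst x = Plus" "fst y = Minus"
      using pair_step.intros[of "[]" "snd x" "snd y" v] that by (cases x; cases y) simp
    then show ?thesis
      using steps Cons by (auto intro: rtranclp.rtrancl_into_rtrancl)
  qed
qed

lemma unpaired_no_step: "\<not> pair_step (unpaired w) w'"
proof (induction w arbitrary: w')
  case Nil
  then show ?case by (auto elim: pair_step.cases)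
next
  case (Cons x w)
  have tail: "\<not> pair_step v v'" if "unpaired w = y # v" for y v v'
    using Cons[of "y # v'"] pair_step_Cons[of v v' y] that by auto
  show ?case
  proof
    assume "pair_step (unpaired (x # w)) w'"
    then show False
    proof cases
      case (1 u c d v)
      then show ?thesis
        using Cons tail pair_step.intros[of "tl u" c d v] pair_step.intros[of u c d v]
        by (cases u) (auto split: list.splits if_splits)
    qed
  qed
qed

lemma unpaired_append_cong: "unpaired v = unpaired v' \<Longrightarrow> unpaired (u @ v) = unpaired (u @ v')"
  by (induction u) auto

lemma unpaired_pair: "unpaired ((Plus, c) # (Minus, d) # v) = unpaired v"
  by (auto split: list.splits)

lemma unpaired_step: "pair_step w w' \<Longrightarrow> unpaired w = unpaired w'"
  by (induction rule: pair_step.induct) (metis unpaired_append_cong unpaired_pair)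

lemma unpaired_iff: "pair_step\<^sup>*\<^sup>* w w' \<and> (\<nexists>w''. pair_step w' w'') \<longleftrightarrow> w' = unpaired w"
proof
  assume *: "pair_step\<^sup>*\<^sup>* w w' \<and> (\<nexists>w''. pair_step w' w'')"
  then have "pair_step\<^sup>*\<^sup>* w w'" by simp
  then have "unpaired w = unpaired w'"
    by (induction rule: rtranclp_induct) (auto dest: unpaired_step)
  moreover have "unpaired w' = w'"
    using * unpaired_reachable[of w'] by (metis converse_rtranclpE)
  ultimately show "w' = unpaired w" by simp
qed (auto simp: unpaired_reachable unpaired_no_step)

text \<open>
  The operators take values in an option type, with \<open>None\<close> in the role of \<open>0\<close>. By column
  strictness, each number occurs in at most one cell of a column.
\<close>

definition svt_f :: "nat list \<Rightarrow> nat \<Rightarrow> filling \<Rightarrow> filling option" where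
  "svt_f lam k T =
     (let U = {j. (Minus, j) \<in> set (unpaired (signature lam k T))} in
      if U = {} then None
      else let j = Max U; i = (THE i. k \<in> T (i, j)); b = (i, j); r = (i, j + 1) in
        if k \<in> T r \<and> k + 1 \<in> T r
        then Some (T (r := T r - {k}, b := insert (k + 1) (T b)))
        else Some (T (b := insert (k + 1) (T b - {k}))))"

definition svt_e :: "nat list \<Rightarrow> nat \<Rightarrow> filling \<Rightarrow> filling option" where
  "svt_e lam k T =
     (let U = {j. (Plus, j) \<in> set (unpaired (signature lam k T))} in
      if U = {} then None
      else let j = Min U; i = (THE i. k + 1 \<in> T (i, j)); b = (i, j); l = (i, j - 1) in
        if k \<in> T l \<and> k + 1 \<in> T l
        then Some (T (l := T l - {k + 1}, b := insert k (T b)))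
        else Some (T (b := insert k (T b - {k + 1}))))"


subsection \<open>Decreasing factorizations\<close>

text \<open>
  A factorization is the list \<open>[h\<^sup>m, \<dots>, h\<^sup>1]\<close> of its factors, so that the factor with upper index
  \<open>a\<close> sits at position \<open>m - a\<close> and the product is \<open>concat h\<close>.
\<close>

definition factor :: "nat list list \<Rightarrow> nat \<Rightarrow> nat list" where
  "factor h a = h ! (length h - a)"

definition set_factor :: "nat list list \<Rightarrow> nat \<Rightarrow> nat list \<Rightarrow> nat list list" where
  "set_factor h a w = h[length h - a := w]"

definition decreasing_word :: "nat set \<Rightarrow> nat list" where
  "decreasing_word A = rev (sorted_list_of_set A)"

inductive hecke_step :: "nat list \<Rightarrow> nat list \<Rightarrow> bool" where
  commute: "p + 1 < q \<or> q + 1 < p \<Longrightarrow> hecke_step (u @ [p, q] @ v) (u @ [q, p] @ v)"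
| braid: "hecke_step (u @ [p, q, p] @ v) (u @ [q, p, q] @ v)"
| idem: "hecke_step (u @ [p, p] @ v) (u @ [p] @ v)"

definition hecke_equiv :: "nat list \<Rightarrow> nat list \<Rightarrow> bool" where
  "hecke_equiv = equivclp hecke_step"

definition hecke_reduced :: "nat list \<Rightarrow> bool" where
  "hecke_reduced w \<longleftrightarrow> (\<forall>v. hecke_equiv w v \<longrightarrow> length w \<le> length v)"

definition fully_commutative :: "nat list \<Rightarrow> bool" where
  "fully_commutative w \<longleftrightarrow>
     (\<forall>v. hecke_equiv w v \<and> hecke_reduced v \<longrightarrow>
        (\<nexists>s t i. v = s @ [i, i + 1, i] @ t \<or> v = s @ [i + 1, i, i + 1] @ t))"

definition H_star :: "nat \<Rightarrow> nat list list set" where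
  "H_star m = {h. length h = m \<and>
     (\<forall>w \<in> set h. sorted_wrt (>) w \<and> 0 \<notin> set w) \<and> fully_commutative (concat h)}"

text \<open>
  In \<open>star_pairs bs A\<close> the letters \<open>bs\<close> are treated from left to right, and \<open>A\<close> is the set of
  letters that are not yet paired. The \<open>\<star>\<close>-operators below are meant for arguments in
  \<open>H_star m\<close>; their rules make sense for any list of decreasing words.
\<close>

fun star_pairs :: "nat list \<Rightarrow> nat set \<Rightarrow> (nat \<times> nat) set" where
  "star_pairs [] A = {}"
| "star_pairs (b # bs) A =
     (let C = {a \<in> A. b \<le> a} in
      if C = {} then star_pairs bs A
      else insert (b, Min C) (star_pairs bs (A - {Min C})))"

definition star_f :: "nat \<Rightarrow> nat list list \<Rightarrow> nat list list option" where
  "star_f k h =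
     (let A = set (factor h k); B = set (factor h (k + 1));
          U = A - snd ` star_pairs (factor h (k + 1)) A in
      if U = {} then None
      else let x = Max U; z = (if x + 1 \<in> A \<inter> B then x + 1 else x) in
        Some (set_factor (set_factor h k (decreasing_word (A - {z})))
                (k + 1) (decreasing_word (insert x B))))"

definition star_e :: "nat \<Rightarrow> nat list list \<Rightarrow> nat list list option" where
  "star_e k h =
     (let A = set (factor h k); B = set (factor h (k + 1));
          U = B - fst ` star_pairs (factor h (k + 1)) A in
      if U = {} then None
      else let y = Min U; z = (if y - 1 \<in> A \<inter> B then y - 1 else y) in
        Some (set_factor (set_factor h (k + 1) (decreasing_word (B - {z})))
                k (decreasing_word (insert y A))))"


subsection \<open>Residue map\<close>

text \<open>
  Truncated subtraction is harmless here: rows of cells satisfy \<open>i \<le> length lam\<close>. Cells of a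
  set-valued tableau containing the same number have distinct contents, so the decreasing list of
  contents is determined by the set of contents.
\<close>

definition content :: "nat list \<Rightarrow> nat \<times> nat \<Rightarrow> nat" where
  "content lam c = length lam + snd c - fst c"

definition res :: "nat \<Rightarrow> nat list \<Rightarrow> filling \<Rightarrow> nat list list" where
  "res m lam T = map (\<lambda>a. decreasing_word (content lam ` {c. a \<in> T c})) (rev [1..<m + 1])"

end

theory Submission
  imports Defs
begin

text \<open>
  Both pairings are bracketings. The \<open>\<star>\<close>-pairing cancels \<open>+ -\<close> in the word that lists the
  residues of \<open>k\<close> as \<open>-\<close> and those of \<open>k + 1\<close> as \<open>+\<close> in increasing order, with \<open>+\<close> first at
  equal residues. A column containing both numbers has them either in one cell, contributing
  \<open>+ -\<close>, or in a vertical domino. Dominoes of consecutive contents lie side by side, and a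
  maximal row of them contributes \<open>+ (+ -) \<dots> (+ -) -\<close>; all of this cancels. What is left comes
  from the columns containing only one of the two numbers, where the content increases strictly
  with the column, so it is the signature. In a column with an unpaired sign, the neighbouring
  cell tested by the crystal operator is the only place where the neighbouring content can occur,
  so the case distinctions of the operators agree as well.
\<close>

subsection \<open>Images and total relations\<close>

lemma image_section_apsnd: "g ` {y. (x, y) \<in> S} = {z. (x, z) \<in> apsnd g ` S}"
  by force

lemma mono_on_Max_commute:
  fixes f :: "'a::linorder \<Rightarrow> 'b::linorder"
  assumes "mono_on A f" "finite A" "A \<noteq> {}"
  shows "f (Max A) = Max (f ` A)"
  using assms(2,3) by (intro Max_eqI[symmetric]) (auto intro!: mono_onD[OF assms(1)] Max_in)

lemma mono_on_Min_commute:
  fixes f :: "'a::linorder \<Rightarrow> 'b::linorder"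
  assumes "mono_on A f" "finite A" "A \<noteq> {}"
  shows "f (Min A) = Min (f ` A)"
  using assms(2,3) by (intro Min_eqI[symmetric]) (auto intro!: mono_onD[OF assms(1)] Min_in)

lemma totalp_on_insertI:
  assumes "totalp_on X R" "\<And>d. d \<in> X \<Longrightarrow> R c d \<or> R d c"
  shows "totalp_on (insert c X) R"
  using assms by (auto simp: totalp_on_def)


subsection \<open>Sign words\<close>

primrec sign_word :: "nat set \<Rightarrow> nat set \<Rightarrow> nat list \<Rightarrow> (sign \<times> nat) list" where
  "sign_word A B [] = []"
| "sign_word A B (x # xs) =
     (if x \<in> B then [(Plus, x)] else []) @ (if x \<in> A then [(Minus, x)] else []) @ sign_word A B xs"

lemma sign_word_append: "sign_word A B (xs @ ys) = sign_word A B xs @ sign_word A B ys"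
  by (induction xs) auto

lemma sign_word_upt_split:
  assumes "l \<le> m" "m \<le> n"
  shows "sign_word A B [l..<n] = sign_word A B [l..<m] @ sign_word A B [m..<n]"
  using assms upt_add_eq_append[of l m "n - m"] by (simp add: sign_word_append)

lemma sign_word_eq_Nil: "set xs \<inter> (A \<union> B) = {} \<Longrightarrow> sign_word A B xs = []"
  by (induction xs) auto

lemma sign_word_cong:
  assumes "A \<inter> set xs = A' \<inter> set xs" "B \<inter> set xs = B' \<inter> set xs"
  shows "sign_word A B xs = sign_word A' B' xs"
proof -
  have "x \<in> A \<longleftrightarrow> x \<in> A'" "x \<in> B \<longleftrightarrow> x \<in> B'" if "x \<in> set xs" for x
    using assms that by blast+
  then show ?thesis
    by (induction xs) auto
qed

lemma set_sign_word: "set (sign_word A B xs) = Pair Minus ` (A \<inter> set xs) \<union> Pair Plus ` (B \<inter> set xs)"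
  by (induction xs) auto

lemma sign_word_filter: "sign_word A B (filter (\<lambda>x. x \<in> A \<union> B) xs) = sign_word A B xs"
  by (induction xs) auto

lemma sign_word_map:
  assumes "inj_on g (A \<union> B \<union> set xs)"
  shows "sign_word (g ` A) (g ` B) (map g xs) = map (apsnd g) (sign_word A B xs)"
  using assms
proof (induction xs)
  case (Cons x xs)
  have "g x \<in> g ` A \<longleftrightarrow> x \<in> A" "g x \<in> g ` B \<longleftrightarrow> x \<in> B"
    using Cons.prems by (auto intro!: inj_on_image_mem_iff)
  moreover have "inj_on g (A \<union> B \<union> set xs)"
    using Cons.prems by (rule inj_on_subset) auto
  ultimately show ?case
    using Cons.IH by simp
qed simp

lemma sign_word_image:
  assumes mono: "strict_mono_on (A \<union> B) g"
    and sorted: "sorted_wrt (<) xs" "sorted_wrt (<) ys"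
    and letters: "A \<union> B \<subseteq> set xs" "g ` (A \<union> B) \<subseteq> set ys"
  shows "sign_word (g ` A) (g ` B) ys = map (apsnd g) (sign_word A B xs)"
proof -
  let ?xs = "filter (\<lambda>x. x \<in> A \<union> B) xs" and ?ys = "filter (\<lambda>y. y \<in> g ` A \<union> g ` B) ys"
  have "sorted_wrt (<) (map g ?xs)"
    unfolding sorted_wrt_map
    by (rule sorted_wrt_mono_rel[OF _ sorted_wrt_filter[OF sorted(1)]])
      (use mono in \<open>auto dest: strict_mono_onD\<close>)
  moreover have "set (map g ?xs) = set ?ys"
    using letters by auto
  ultimately have "?ys = map g ?xs"
    using sorted(2) by (intro strict_sorted_equal sorted_wrt_filter) simp_all
  moreover have "inj_on g (A \<union> B \<union> set ?xs)"
    using strict_mono_on_imp_inj_on[OF mono] by (rule inj_on_subset) auto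
  ultimately show ?thesis
    using sign_word_map[of g A B ?xs] by (metis sign_word_filter)
qed


subsection \<open>Cancellation in sign words\<close>

lemma set_unpaired_subset: "set (unpaired w) \<subseteq> set w"
  by (induction w) (auto split: list.splits if_splits)

lemma unpaired_map_apsnd: "unpaired (map (apsnd g) w) = map (apsnd g) (unpaired w)"
proof (induction w)
  case (Cons x w)
  then show ?case by (cases "unpaired w") simp_all
qed simp

lemma unpaired_Cons_cong: "unpaired w = unpaired w' \<Longrightarrow> unpaired (x # w) = unpaired (x # w')"
  by simp

lemma unpaired_Cons_Minus: "unpaired ((Minus, x) # w) = (Minus, x) # unpaired w"
  by (simp split: list.split)

lemma unpaired_snoc_Plus: "unpaired (w @ [(Plus, x)]) = unpaired w @ [(Plus, x)]"
proof (induction w)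
  case (Cons y w)
  then show ?case by (cases "unpaired w") simp_all
qed simp

lemma unpaired_sign_word_no_Plus: "unpaired (sign_word A {} xs) = sign_word A {} xs"
  by (induction xs) (simp_all add: unpaired_Cons_Minus del: unpaired.simps(2))

lemma sign_word_adjacent_pair:
  assumes "a \<in> A" "b \<in> B" "b \<le> a"
    and between: "A \<inter> {b..<a} = {}" "B \<inter> {b<..a} = {}"
  shows "sign_word A B [b..<Suc a] = [(Plus, b), (Minus, a)]"
proof (cases "a = b")
  case False
  then have "[b..<Suc a] = b # [Suc b..<a] @ [a]"
    using assms(3) by (simp add: upt_conv_Cons)
  moreover have "sign_word A B [Suc b..<a] = []"
    using between by (intro sign_word_eq_Nil) auto
  moreover have "b \<notin> A" "a \<notin> B"
    using between assms(3) False by auto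
  ultimately show ?thesis
    using assms(1,2) by (simp add: sign_word_append)
qed (use assms(1,2) in simp)

lemma unpaired_sign_word_remove_pair:
  assumes "a \<in> A" "b \<in> B" "b \<le> a" "a < h"
    and between: "A \<inter> {b..<a} = {}" "B \<inter> {b<..a} = {}"
  shows "unpaired (sign_word A B [0..<h]) = unpaired (sign_word (A - {a}) (B - {b}) [0..<h])"
proof -
  let ?A = "A - {a}" and ?B = "B - {b}"
  let ?u = "sign_word A B [0..<b]" and ?v = "sign_word A B [Suc a..<h]"
  have split: "sign_word X Y [0..<h] =
      sign_word X Y [0..<b] @ sign_word X Y [b..<Suc a] @ sign_word X Y [Suc a..<h]" for X Y
    using assms(3,4) sign_word_upt_split[of 0 b h] sign_word_upt_split[of b "Suc a" h] by simp
  have "sign_word ?A ?B [0..<b] = ?u" "sign_word ?A ?B [Suc a..<h] = ?v"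
    using assms(3) by (auto intro!: sign_word_cong)
  moreover have "sign_word ?A ?B [b..<Suc a] = []"
    using between by (intro sign_word_eq_Nil) (auto simp: less_Suc_eq le_less)
  ultimately have "sign_word ?A ?B [0..<h] = ?u @ ?v"
    by (simp only: split) simp
  moreover have "sign_word A B [0..<h] = ?u @ (Plus, b) # (Minus, a) # ?v"
    by (simp only: split sign_word_adjacent_pair[OF assms(1-3) between]) simp
  ultimately show ?thesis
    using unpaired_append_cong[OF unpaired_pair] by metis
qed

lemma unpaired_sign_word_Diff_common:
  assumes "S \<subseteq> A \<inter> B"
  shows "unpaired (sign_word A B xs) = unpaired (sign_word (A - S) (B - S) xs)"
proof (induction xs)
  case (Cons x xs)
  show ?case
  proof (cases "x \<in> S")
    case True
    then have "x \<in> A" "x \<in> B"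
      using assms by auto
    with True Cons.IH show ?thesis
      by (simp add: unpaired_pair del: unpaired.simps)
  next
    case False
    then show ?thesis
      using Cons.IH by (auto intro!: unpaired_Cons_cong simp del: unpaired.simps)
  qed
qed simp

text \<open>
  For each maximal interval \<open>{a..<b}\<close> of \<open>W\<close>, the letters from \<open>Plus\<close> at \<open>a\<close> to \<open>Minus\<close> at \<open>b\<close>
  form the factor \<open>+ (+ -) \<dots> (+ -) -\<close>, which cancels completely.
\<close>

lemma unpaired_sign_word_Diff_runs_from:
  assumes "W \<subseteq> B" "Suc ` W \<subseteq> A"
    and extend_right: "\<And>x. x \<in> W \<Longrightarrow> Suc x \<in> B \<Longrightarrow> Suc x \<in> W"
    and extend_left: "\<And>x. x \<in> W \<Longrightarrow> x \<in> A \<Longrightarrow> x \<in> Suc ` W"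
    and "A \<subseteq> {..<h}" "l \<le> h"
  defines "w \<equiv> \<lambda>l. sign_word A B [l..<h]"
    and "w' \<equiv> \<lambda>l. sign_word (A - Suc ` W) (B - W) [l..<h]"
  shows "if l \<in> Suc ` W then \<exists>b. unpaired (w l) = (Minus, b) # unpaired (w' l)
    else unpaired (w l) = unpaired (w' l)"
  using \<open>l \<le> h\<close>
proof (induction l rule: inc_induct)
  case base
  have "h \<notin> Suc ` W"
    using assms(2,5) by auto
  then show ?case by (simp add: w_def w'_def)
next
  case (step l)
  have upt: "[l..<h] = l # [Suc l..<h]"
    using step.hyps by (simp add: upt_conv_Cons)
  have next_run: "Suc l \<in> Suc ` W \<longleftrightarrow> l \<in> W"
    by auto
  have letters: "l \<in> Suc ` W \<Longrightarrow> l \<in> A" "l \<in> W \<Longrightarrow> l \<in> B"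
    "l \<in> Suc ` W \<Longrightarrow> l \<notin> W \<Longrightarrow> l \<notin> B" "l \<in> W \<Longrightarrow> l \<notin> Suc ` W \<Longrightarrow> l \<notin> A"
    using assms(1,2) extend_right extend_left by auto
  consider (inner) "l \<in> Suc ` W" "l \<in> W" | (last) "l \<in> Suc ` W" "l \<notin> W"
    | (first) "l \<notin> Suc ` W" "l \<in> W" | (outside) "l \<notin> Suc ` W" "l \<notin> W"
    by blast
  then show ?case
  proof cases
    case inner
    then show ?thesis
      using step.IH letters by (simp add: w_def w'_def upt unpaired_pair del: unpaired.simps)
  next
    case last
    then show ?thesis
      using step.IH letters next_run
      by (simp add: w_def w'_def upt unpaired_Cons_Minus del: unpaired.simps)
  next
    case first
    then show ?thesis
      using step.IH letters by (auto simp: w_def w'_def upt)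
  next
    case outside
    then show ?thesis
      using step.IH next_run
      by (auto simp: w_def w'_def upt intro!: unpaired_Cons_cong simp del: unpaired.simps)
  qed
qed

lemma unpaired_sign_word_Diff_runs:
  assumes "W \<subseteq> B" "Suc ` W \<subseteq> A"
    and "\<And>x. x \<in> W \<Longrightarrow> Suc x \<in> B \<Longrightarrow> Suc x \<in> W"
    and "\<And>x. x \<in> W \<Longrightarrow> x \<in> A \<Longrightarrow> x \<in> Suc ` W"
    and "A \<subseteq> {..<h}"
  shows "unpaired (sign_word A B [0..<h]) = unpaired (sign_word (A - Suc ` W) (B - W) [0..<h])"
  using unpaired_sign_word_Diff_runs_from[OF assms, of 0] by (simp add: image_iff)


subsection \<open>The pairing of letters as bracketing\<close>

lemma sign_word_insert_last_Plus:
  assumes "A \<subseteq> {..<b}" "B \<subseteq> {..<b}" "b < h"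
  shows "sign_word A (insert b B) [0..<h] = sign_word A B [0..<h] @ [(Plus, b)]"
proof -
  have split: "sign_word X Y [0..<h] = sign_word X Y [0..<b] @ sign_word X Y [b..<h]" for X Y
    using assms(3) by (simp add: sign_word_upt_split)
  have "sign_word A (insert b B) [0..<b] = sign_word A B [0..<b]"
    by (rule sign_word_cong) auto
  moreover have "sign_word A B [b..<h] = []" "sign_word A (insert b B) [Suc b..<h] = []"
    using assms(1,2) by (auto intro!: sign_word_eq_Nil)
  moreover from this have "sign_word A (insert b B) [b..<h] = [(Plus, b)]"
    using assms(1,3) by (auto simp: upt_conv_Cons[of b h])
  ultimately show ?thesis
    by (simp only: split append_Nil2)
qed

text \<open>
  The greatest letter \<open>b\<close> of the second set and the least letter \<open>a \<ge> b\<close> of the first are adjacent.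
\<close>

lemma unpaired_sign_word_insert_last_pair:
  assumes "A \<subseteq> {..<h}" "B \<subseteq> {..<b}" "{a \<in> A. b \<le> a} \<noteq> {}"
  shows "unpaired (sign_word A (insert b B) [0..<h]) =
    unpaired (sign_word (A - {Min {a \<in> A. b \<le> a}}) B [0..<h])"
proof -
  let ?C = "{a \<in> A. b \<le> a}"
  have "finite ?C"
    using assms(1) finite_subset by fastforce
  then have Min: "Min ?C \<in> ?C" and least: "\<forall>a \<in> ?C. Min ?C \<le> a"
    using Min_in assms(3) by auto
  have "A \<inter> {b..<Min ?C} = {}"
    using least by force
  moreover have "insert b B \<inter> {b<..Min ?C} = {}"
    using assms(2) by auto
  moreover have "insert b B - {b} = B"
    using assms(2) by auto
  ultimately show ?thesis
    using unpaired_sign_word_remove_pair[of "Min ?C" A b "insert b B" h] Min assms(1) by auto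
qed

lemma star_pairs_subset:
  assumes "finite A"
  shows "star_pairs bs A \<subseteq> set bs \<times> A"
  using assms
proof (induction bs arbitrary: A)
  case (Cons b bs)
  have "Min {a \<in> A. b \<le> a} \<in> A" if "{a \<in> A. b \<le> a} \<noteq> {}"
    using Min_in[OF _ that] Cons.prems by simp
  then show ?case
    using Cons.IH[of A] Cons.IH[of "A - {Min {a \<in> A. b \<le> a}}"] Cons.prems
    by (auto simp: Let_def)
qed simp

lemma unpaired_sign_word_star_pairs:
  assumes "sorted_wrt (>) bs" "A \<subseteq> {..<h}" "set bs \<subseteq> {..<h}"
  shows "set (unpaired (sign_word A (set bs) [0..<h])) =
    Pair Minus ` (A - snd ` star_pairs bs A) \<union> Pair Plus ` (set bs - fst ` star_pairs bs A)"
  using assms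
proof (induction bs arbitrary: A)
  case Nil
  then show ?case
    by (auto simp: unpaired_sign_word_no_Plus set_sign_word)
next
  case (Cons b bs)
  have finite: "finite A"
    using Cons.prems(2) finite_subset by blast
  have less: "\<forall>x \<in> set bs. x < b"
    using Cons.prems(1) by simp
  show ?case
  proof (cases "{a \<in> A. b \<le> a} = {}")
    case True
    then have "sign_word A (set (b # bs)) [0..<h] = sign_word A (set bs) [0..<h] @ [(Plus, b)]"
      using less Cons.prems(3) unfolding list.set by (intro sign_word_insert_last_Plus) auto
    moreover have "star_pairs (b # bs) A = star_pairs bs A"
      using True by (simp add: Let_def)
    moreover have "b \<notin> fst ` star_pairs bs A"
      using star_pairs_subset[OF finite, of bs] less by auto
    ultimately show ?thesis
      using Cons.IH[of A] Cons.prems by (auto simp: unpaired_snoc_Plus)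
  next
    case False
    define a where "a = Min {a \<in> A. b \<le> a}"
    have "unpaired (sign_word A (set (b # bs)) [0..<h]) =
        unpaired (sign_word (A - {a}) (set bs) [0..<h])"
      unfolding a_def list.set using Cons.prems(2) less False
      by (intro unpaired_sign_word_insert_last_pair) auto
    moreover have "star_pairs (b # bs) A = insert (b, a) (star_pairs bs (A - {a}))"
      using False by (auto simp: Let_def a_def)
    moreover have "set (unpaired (sign_word (A - {a}) (set bs) [0..<h])) =
        Pair Minus ` (A - {a} - snd ` star_pairs bs (A - {a})) \<union>
        Pair Plus ` (set bs - fst ` star_pairs bs (A - {a}))"
      using Cons.prems by (intro Cons.IH) auto
    moreover have "A - {a} - snd ` P = A - snd ` insert (b, a) P"
      "set bs - fst ` P = set (b # bs) - fst ` insert (b, a) P" for P :: "(nat \<times> nat) set"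
      using less by auto
    ultimately show ?thesis by (simp only:)
  qed
qed

lemma sorted_wrt_decreasing_word: "sorted_wrt (>) (decreasing_word A)"
  by (simp add: decreasing_word_def sorted_wrt_rev)

lemma set_decreasing_word: "finite A \<Longrightarrow> set (decreasing_word A) = A"
  by (simp add: decreasing_word_def)


subsection \<open>Cells and their contents\<close>

definition southeast :: "nat \<times> nat \<Rightarrow> nat \<times> nat \<Rightarrow> bool" where
  "southeast c d \<longleftrightarrow> snd c < snd d \<and> fst d \<le> fst c"

lemma content_less_if_southeast:
  "southeast c d \<Longrightarrow> fst c \<le> length lam \<Longrightarrow> content lam c < content lam d"
  by (auto simp: southeast_def content_def)

lemma southeast_content_Suc:
  "southeast c d \<Longrightarrow> fst c \<le> length lam \<Longrightarrow> content lam d = Suc (content lam c) \<Longrightarrow>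
    d = (fst c, Suc (snd c))"
  by (cases d) (auto simp: southeast_def content_def)

lemma content_right: "i \<le> length lam \<Longrightarrow> content lam (i, Suc j) = Suc (content lam (i, j))"
  by (simp add: content_def Suc_diff_le)

lemma inj_on_snd_if_total: "totalp_on X southeast \<Longrightarrow> inj_on snd X"
  by (intro inj_onI) (metis less_irrefl southeast_def totalp_onD)

lemma inj_on_content_if_total:
  assumes "totalp_on X southeast" "\<And>c. c \<in> X \<Longrightarrow> fst c \<le> length lam"
  shows "inj_on (content lam) X"
  using assms by (intro inj_onI) (metis content_less_if_southeast less_irrefl totalp_onD)

lemma Suc_content_mem_iff:
  assumes "totalp_on (insert (i, j) X) southeast" "\<And>c. c \<in> insert (i, j) X \<Longrightarrow> fst c \<le> length lam"
  shows "Suc (content lam (i, j)) \<in> content lam ` X \<longleftrightarrow> (i, Suc j) \<in> X"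
proof
  assume "Suc (content lam (i, j)) \<in> content lam ` X"
  then obtain d where d: "d \<in> X" "content lam d = Suc (content lam (i, j))"
    by (metis imageE)
  then have "southeast (i, j) d \<or> southeast d (i, j)"
    using totalp_onD[OF assms(1), of "(i, j)" d] by force
  then have "southeast (i, j) d"
    using d content_less_if_southeast[of d "(i, j)" lam] assms(2)[of d] by auto
  then show "(i, Suc j) \<in> X"
    using d southeast_content_Suc[of "(i, j)" d lam] assms(2)[of "(i, j)"] by simp
next
  assume "(i, Suc j) \<in> X"
  moreover have "content lam (i, Suc j) = Suc (content lam (i, j))"
    using assms(2)[of "(i, j)"] by (simp add: content_right)
  ultimately show "Suc (content lam (i, j)) \<in> content lam ` X"
    by (metis imageI)
qed

lemma pred_content_mem_iff:
  assumes "totalp_on (insert (i, Suc j) X) southeast"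
    "\<And>c. c \<in> insert (i, Suc j) X \<Longrightarrow> fst c \<le> length lam"
  shows "content lam (i, Suc j) - 1 \<in> content lam ` X \<longleftrightarrow> (i, j) \<in> X"
proof -
  have content: "content lam (i, Suc j) = Suc (content lam (i, j))"
    using assms(2)[of "(i, Suc j)"] by (simp add: content_right)
  show ?thesis
  proof
    assume "content lam (i, Suc j) - 1 \<in> content lam ` X"
    then obtain d where d: "d \<in> X" "content lam (i, Suc j) = Suc (content lam d)"
      using content by (metis diff_Suc_1 imageE)
    then have "southeast (i, Suc j) d \<or> southeast d (i, Suc j)"
      using totalp_onD[OF assms(1), of "(i, Suc j)" d] by force
    then have "southeast d (i, Suc j)"
      using d content_less_if_southeast[of "(i, Suc j)" d lam] assms(2)[of "(i, Suc j)"] by auto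
    then show "(i, j) \<in> X"
      using d southeast_content_Suc[of d "(i, Suc j)" lam] assms(2)[of d] by (cases d) simp
  qed (use content in force)
qed


subsection \<open>Occurrences of a number in a filling\<close>

definition occurrences :: "filling \<Rightarrow> nat \<Rightarrow> (nat \<times> nat) set" where
  "occurrences T a = {c. a \<in> T c}"

definition residues :: "nat list \<Rightarrow> filling \<Rightarrow> nat \<Rightarrow> nat set" where
  "residues lam T a = content lam ` occurrences T a"

definition lone_occurrences :: "filling \<Rightarrow> nat \<Rightarrow> nat \<Rightarrow> (nat \<times> nat) set" where
  "lone_occurrences T a b = {c \<in> occurrences T a. \<not> in_column T (snd c) b}"

lemma signature_eq_sign_word:
  "signature lam k T = sign_word (snd ` lone_occurrences T k (Suc k))
     (snd ` lone_occurrences T (Suc k) k) [1..<part lam 1 + 1]"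
proof -
  have "j \<in> snd ` lone_occurrences T a b \<longleftrightarrow> in_column T j a \<and> \<not> in_column T j b" for j a b
    by (force simp: lone_occurrences_def occurrences_def in_column_def)
  then have "List.map_filter (column_sign T k) js = sign_word (snd ` lone_occurrences T k (Suc k))
     (snd ` lone_occurrences T (Suc k) k) js" for js
    by (induction js) (simp_all add: List.map_filter_simps column_sign_def)
  then show ?thesis by (simp add: signature_def)
qed

definition move_entry :: "filling \<Rightarrow> nat \<times> nat \<Rightarrow> nat \<Rightarrow> nat \<times> nat \<Rightarrow> nat \<Rightarrow> filling" where
  "move_entry T d a c b = (let S = T(d := T d - {a}) in S(c := insert b (S c)))"

lemma occurrences_move_entry:
  assumes "a \<noteq> b"
  shows "occurrences (move_entry T d a c b) x =
    (if x = a then occurrences T a - {d} else if x = b then insert c (occurrences T b)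
     else occurrences T x)"
  using assms by (auto simp: occurrences_def move_entry_def Let_def split: if_splits)

lemma length_res [simp]: "length (res m lam T) = m"
  by (simp add: res_def)

lemma nth_res: "p < m \<Longrightarrow> res m lam T ! p = decreasing_word (residues lam T (m - p))"
  by (simp add: res_def residues_def occurrences_def rev_nth Suc_diff_Suc del: upt_Suc)

lemma factor_res:
  assumes "1 \<le> a" "a \<le> m"
  shows "factor (res m lam T) a = decreasing_word (residues lam T a)"
  using assms by (simp add: factor_def nth_res)

lemma res_move_entry:
  assumes "1 \<le> a" "a \<le> m" "1 \<le> b" "b \<le> m" "a \<noteq> b"
    and "inj_on (content lam) (occurrences T a)" "d \<in> occurrences T a"
  shows "res m lam (move_entry T d a c b) =
    set_factor (set_factor (res m lam T) a (decreasing_word (residues lam T a - {content lam d})))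
      b (decreasing_word (insert (content lam c) (residues lam T b)))"
proof (rule nth_equalityI)
  fix p assume "p < length (res m lam (move_entry T d a c b))"
  then have p: "p < m" by simp
  have "m - a = p \<longleftrightarrow> m - p = a" "m - b = p \<longleftrightarrow> m - p = b"
    using p assms(1-4) by auto
  moreover have "content lam ` (occurrences T a - {d}) = residues lam T a - {content lam d}"
    using inj_on_image_set_diff[OF assms(6), of "occurrences T a" "{d}"] assms(7)
    by (simp add: residues_def)
  ultimately show "res m lam (move_entry T d a c b) ! p = set_factor (set_factor (res m lam T) a
      (decreasing_word (residues lam T a - {content lam d})))
      b (decreasing_word (insert (content lam c) (residues lam T b))) ! p"
    using p assms(5)
    by (auto simp: set_factor_def nth_list_update nth_res residues_def occurrences_move_entry)
qed (simp add: set_factor_def)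


subsection \<open>Set-valued tableaux\<close>

lemma part_antimono:
  assumes "is_partition lam" "1 \<le> i" "i \<le> i'"
  shows "part lam i' \<le> part lam i"
proof (cases "i = i' \<or> length lam < i'")
  case True
  then show ?thesis by (auto simp: part_def)
next
  case False
  then show ?thesis
    using assms sorted_wrt_nth_less[of "(\<ge>)" lam "i - 1" "i' - 1"]
    by (auto simp: part_def is_partition_def)
qed

lemma skew_cells_convex:
  assumes "is_partition lam" "is_partition mu"
    and "(i, j) \<in> skew_cells lam mu" "(i', j') \<in> skew_cells lam mu"
    and "i \<le> r" "r \<le> i'" "j \<le> s" "s \<le> j'"
  shows "(r, s) \<in> skew_cells lam mu"
  using assms part_antimono[OF assms(1), of r i'] part_antimono[OF assms(2), of i r]
  by (auto simp: skew_cells_def)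

locale set_valued_tableau =
  fixes m :: nat and lam mu :: "nat list" and T :: filling
  assumes partition_lam: "is_partition lam" and partition_mu: "is_partition mu"
    and SVT: "T \<in> SVT m lam mu"
begin

lemma cell_in_shape:
  assumes "a \<in> T c"
  shows "c \<in> skew_cells lam mu"
proof (rule ccontr)
  assume "c \<notin> skew_cells lam mu"
  then have "T c = {}"
    using SVT unfolding SVT_def by blast
  with assms show False by simp
qed

lemma cell_bounds:
  assumes "c \<in> occurrences T a"
  shows "fst c \<le> length lam" "1 \<le> snd c" "snd c \<le> part lam 1"
proof -
  obtain i j where c: "c = (i, j)" by fastforce
  have cell: "1 \<le> i" "part mu i < j" "j \<le> part lam i"
    using cell_in_shape[of a c] assms by (auto simp: c occurrences_def skew_cells_def)
  then show "fst c \<le> length lam"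
    by (auto simp: c part_def split: if_splits)
  show "1 \<le> snd c" "snd c \<le> part lam 1"
    using cell part_antimono[OF partition_lam, of 1 i] by (auto simp: c)
qed

lemma finite_entries: "finite (T c)"
proof (cases "c \<in> skew_cells lam mu")
  case True
  then have "T c \<subseteq> {1..m}"
    using SVT unfolding SVT_def by blast
  then show ?thesis
    by (rule finite_subset) simp
next
  case False
  then have "T c = {}"
    using SVT unfolding SVT_def by blast
  then show ?thesis by simp
qed

lemma entry_between:
  assumes "a \<in> T (i, j)" "b \<in> T (i', j')" "i \<le> r" "r \<le> i'" "j \<le> s" "s \<le> j'"
  obtains c where "c \<in> T (r, s)"
proof -
  have "(r, s) \<in> skew_cells lam mu"
    using skew_cells_convex[OF partition_lam partition_mu cell_in_shape cell_in_shape] assms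
    by blast
  then have "T (r, s) \<noteq> {}"
    using SVT unfolding SVT_def by blast
  then show thesis
    using that by blast
qed

lemma row_le:
  assumes "a \<in> T (i, j)" "b \<in> T (i, j')" "j < j'"
  shows "a \<le> b"
  using assms(2,3)
proof (induction j' arbitrary: b)
  case (Suc s)
  obtain c where c: "c \<in> T (i, s)" "a \<le> c"
  proof (cases "j = s")
    case False
    then have "j < s"
      using Suc.prems(2) by simp
    moreover from this obtain c where "c \<in> T (i, s)"
      using entry_between[OF assms(1) Suc.prems(1), of i s] by auto
    ultimately show thesis
      using Suc.IH that by blast
  qed (use assms(1) in blast)
  have "Max (T (i, s)) \<le> Min (T (i, Suc s))"
    using SVT cell_in_shape c(1) Suc.prems(1) by (simp add: SVT_def)
  then show ?case
    using c(2) Max_ge[OF finite_entries c(1)] Min_le[OF finite_entries Suc.prems(1)] by linarith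
qed simp

lemma column_growth:
  assumes "a \<in> T (i, j)" "b \<in> T (i', j)" "i < i'"
  shows "a + (i' - i) \<le> b"
  using assms(2,3)
proof (induction i' arbitrary: b)
  case (Suc r)
  obtain c where c: "c \<in> T (r, j)" "a + (r - i) \<le> c"
  proof (cases "i = r")
    case False
    then have "i < r"
      using Suc.prems(2) by simp
    moreover from this obtain c where "c \<in> T (r, j)"
      using entry_between[OF assms(1) Suc.prems(1), of r j] by auto
    ultimately show thesis
      using Suc.IH that by blast
  qed (use assms(1) in auto)
  have "Max (T (r, j)) < Min (T (Suc r, j))"
    using SVT cell_in_shape c(1) Suc.prems(1) by (simp add: SVT_def)
  then show ?case
    using c(2) Max_ge[OF finite_entries c(1)] Min_le[OF finite_entries Suc.prems(1)] Suc.prems(2)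
    by linarith
qed simp

lemma entry_growth:
  assumes "a \<in> T (i, j)" "b \<in> T (i', j')" "i < i'" "j \<le> j'"
  shows "a + (i' - i) \<le> b"
proof (cases "j = j'")
  case False
  obtain c where c: "c \<in> T (i', j)"
    using entry_between[OF assms(1,2), of i' j] assms(3,4) by auto
  then show ?thesis
    using column_growth[OF assms(1) c assms(3)] row_le[OF c assms(2)] False assms(4) by simp
qed (use column_growth assms in blast)

lemma totalp_on_occurrences: "totalp_on (occurrences T a) southeast"
proof (rule totalp_onI)
  have right: "j' < j" if "a \<in> T (i, j)" "a \<in> T (i', j')" "i < i'" for i j i' j'
    using entry_growth[OF that] that(3) by (cases "j' < j") auto
  fix c d assume "c \<in> occurrences T a" "d \<in> occurrences T a" "c \<noteq> d"
  then show "southeast c d \<or> southeast d c"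
    using right[of "fst c" "snd c" "fst d" "snd d"] right[of "fst d" "snd d" "fst c" "snd c"]
    by (cases "fst c" "fst d" rule: linorder_cases)
      (auto simp: occurrences_def southeast_def prod_eq_iff)
qed

lemma inj_on_content: "inj_on (content lam) (occurrences T a)"
  using totalp_on_occurrences cell_bounds(1) by (rule inj_on_content_if_total)

lemma consecutive_entries:
  assumes "k \<in> T (i, j)" "Suc k \<in> T (i', j')" "i < i'" "j \<le> j'"
  shows "i' = Suc i" "Suc k \<in> T (i', j)" "k \<in> T (i, j')"
proof -
  show i': "i' = Suc i"
    using entry_growth[OF assms] assms(3) by simp
  obtain b where b: "b \<in> T (i', j)"
    using entry_between[OF assms(1,2), of i' j] assms(3,4) by auto
  obtain a where a: "a \<in> T (i, j')"
    using entry_between[OF assms(1,2), of i j'] assms(3,4) by auto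
  show "Suc k \<in> T (i', j)"
    using column_growth[OF assms(1) b assms(3)] row_le[OF b assms(2)] b assms(2,4)
    by (cases "j = j'") (auto simp: i' le_antisym)
  show "k \<in> T (i, j')"
    using row_le[OF assms(1) a] column_growth[OF a assms(2,3)] a assms(1,4)
    by (cases "j = j'") (auto simp: i' le_antisym)
qed

lemma lone_occurrences_comparable:
  assumes "c \<in> occurrences T k" "d \<in> occurrences T (Suc k)"
    and "c \<in> lone_occurrences T k (Suc k) \<or> d \<in> lone_occurrences T (Suc k) k"
  shows "southeast c d \<or> southeast d c"
proof -
  obtain i j i' j' where cd: "c = (i, j)" "d = (i', j')" by fastforce
  have k: "k \<in> T (i, j)" "Suc k \<in> T (i', j')"
    using assms(1,2) by (auto simp: cd occurrences_def)
  have "j \<noteq> j'"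
    using assms k by (auto simp: cd lone_occurrences_def in_column_def)
  moreover have "\<not> (i < i' \<and> j \<le> j')"
    using consecutive_entries[OF k] assms(3) by (auto simp: cd lone_occurrences_def in_column_def)
  moreover have "\<not> (i' < i \<and> j' \<le> j)"
    using entry_growth[OF k(2,1)] by fastforce
  ultimately show ?thesis
    by (auto simp: cd southeast_def)
qed

lemma totalp_on_insert_lone:
  "c \<in> lone_occurrences T k (Suc k) \<Longrightarrow> totalp_on (insert c (occurrences T (Suc k))) southeast"
  "d \<in> lone_occurrences T (Suc k) k \<Longrightarrow> totalp_on (insert d (occurrences T k)) southeast"
  using lone_occurrences_comparable
  by (intro totalp_on_insertI totalp_on_occurrences; simp add: lone_occurrences_def; blast)+

abbreviation lone_cells :: "nat \<Rightarrow> (nat \<times> nat) set" where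
  "lone_cells k \<equiv> lone_occurrences T k (Suc k) \<union> lone_occurrences T (Suc k) k"

lemma totalp_on_lone_cells: "totalp_on (lone_cells k) southeast"
proof (rule totalp_onI)
  fix c d assume "c \<in> lone_cells k" "d \<in> lone_cells k" "c \<noteq> d"
  then show "southeast c d \<or> southeast d c"
    using totalp_onD[OF totalp_on_occurrences, of c _ d] lone_occurrences_comparable[of c k d]
      lone_occurrences_comparable[of d k c]
    by (auto simp: lone_occurrences_def)
qed

lemma the_row: "(i, j) \<in> occurrences T a \<Longrightarrow> (THE i. a \<in> T (i, j)) = i"
  using inj_onD[OF inj_on_snd_if_total[OF totalp_on_occurrences]]
  by (intro the_equality) (fastforce simp: occurrences_def)+


subsection \<open>The signature in terms of contents\<close>

definition domino_bottoms :: "nat \<Rightarrow> (nat \<times> nat) set" where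
  "domino_bottoms k = {(i, j). (i, j) \<in> occurrences T k \<and> (Suc i, j) \<in> occurrences T (Suc k)}"

definition domino_tops :: "nat \<Rightarrow> (nat \<times> nat) set" where
  "domino_tops k = (\<lambda>(i, j). (Suc i, j)) ` domino_bottoms k"

lemma dominoes_subset:
  "domino_bottoms k \<subseteq> occurrences T k" "domino_tops k \<subseteq> occurrences T (Suc k)"
  by (auto simp: domino_bottoms_def domino_tops_def)

lemma dominoes_disjoint:
  "domino_bottoms k \<inter> occurrences T (Suc k) = {}" "domino_tops k \<inter> occurrences T k = {}"
proof -
  have "(i, j) \<notin> occurrences T (Suc k) \<and> (Suc i, j) \<notin> occurrences T k"
    if "(i, j) \<in> domino_bottoms k" for i j
    using that column_growth[of k i j k "Suc i"] column_growth[of "Suc k" i j "Suc k" "Suc i"]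
    by (auto simp: domino_bottoms_def occurrences_def)
  then show "domino_bottoms k \<inter> occurrences T (Suc k) = {}" "domino_tops k \<inter> occurrences T k = {}"
    by (auto simp: domino_tops_def)
qed

lemma content_domino_bottom:
  assumes "(i, j) \<in> domino_bottoms k"
  shows "content lam (i, j) = Suc (content lam (Suc i, j))"
  using cell_bounds(1)[of "(Suc i, j)" "Suc k"] assms
  by (simp add: domino_bottoms_def content_def Suc_diff_Suc)

lemma content_domino_bottoms: "content lam ` domino_bottoms k = Suc ` content lam ` domino_tops k"
  unfolding domino_tops_def image_image
  by (intro image_cong) (auto simp: content_domino_bottom)

lemma lone_occurrences_eq:
  "lone_occurrences T k (Suc k) =
     occurrences T k - domino_bottoms k - occurrences T k \<inter> occurrences T (Suc k)"
  "lone_occurrences T (Suc k) k =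
     occurrences T (Suc k) - domino_tops k - occurrences T k \<inter> occurrences T (Suc k)"
proof -
  have same_column: "i' = i \<or> (i, j) \<in> domino_bottoms k \<and> i' = Suc i"
    if "(i, j) \<in> occurrences T k" "(i', j) \<in> occurrences T (Suc k)" for i i' j
  proof (cases i i' rule: linorder_cases)
    case less
    then show ?thesis
      using consecutive_entries(1)[of k i j i' j] that
      by (simp add: occurrences_def domino_bottoms_def)
  next
    case greater
    then show ?thesis
      using column_growth[of "Suc k" i' j k i] that by (simp add: occurrences_def)
  qed simp
  have "in_column T j (Suc k) \<longleftrightarrow> (i, j) \<in> domino_bottoms k \<union> occurrences T (Suc k)"
    if "(i, j) \<in> occurrences T k" for i j
    using same_column[OF that] by (auto simp: in_column_def occurrences_def domino_bottoms_def)
  then show "lone_occurrences T k (Suc k) =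
      occurrences T k - domino_bottoms k - occurrences T k \<inter> occurrences T (Suc k)"
    by (force simp: lone_occurrences_def)
  have "in_column T j k \<longleftrightarrow> (i', j) \<in> domino_tops k \<union> occurrences T k"
    if "(i', j) \<in> occurrences T (Suc k)" for i' j
    using same_column[OF _ that]
    by (force simp: in_column_def occurrences_def domino_bottoms_def domino_tops_def)
  then show "lone_occurrences T (Suc k) k =
      occurrences T (Suc k) - domino_tops k - occurrences T k \<inter> occurrences T (Suc k)"
    by (force simp: lone_occurrences_def)
qed

lemma domino_right:
  assumes "(i, j) \<in> domino_bottoms k" "content lam (i, j) \<in> residues lam T (Suc k)"
  shows "(i, Suc j) \<in> domino_bottoms k"
proof -
  have K: "(i, j) \<in> occurrences T k" and P: "(Suc i, j) \<in> occurrences T (Suc k)"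
    using assms(1) by (auto simp: domino_bottoms_def)
  then have "insert (Suc i, j) (occurrences T (Suc k)) = occurrences T (Suc k)"
    by blast
  then have right: "(Suc i, Suc j) \<in> occurrences T (Suc k)"
    using Suc_content_mem_iff[of "Suc i" j "occurrences T (Suc k)" lam] assms(2)
      totalp_on_occurrences cell_bounds(1)
    by (simp add: content_domino_bottom[OF assms(1)] residues_def)
  with K have "(i, Suc j) \<in> occurrences T k"
    using consecutive_entries(3)[of k i j "Suc i" "Suc j"] by (simp add: occurrences_def)
  with right show ?thesis
    by (simp add: domino_bottoms_def)
qed

lemma domino_left:
  assumes "(i, j) \<in> domino_bottoms k" "content lam (Suc i, j) \<in> residues lam T k"
  shows "(i, j - 1) \<in> domino_bottoms k"
proof -
  have K: "(i, j) \<in> occurrences T k" and P: "(Suc i, j) \<in> occurrences T (Suc k)"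
    using assms(1) by (auto simp: domino_bottoms_def)
  obtain l where j: "j = Suc l"
    using cell_bounds(2)[OF K] by (cases j) auto
  have "insert (i, Suc l) (occurrences T k) = occurrences T k"
    using K j by blast
  then have left: "(i, l) \<in> occurrences T k"
    using pred_content_mem_iff[of i l "occurrences T k" lam] assms(2)
      totalp_on_occurrences cell_bounds(1) content_domino_bottom[OF assms(1)]
    by (simp add: residues_def j)
  with P have "(Suc i, l) \<in> occurrences T (Suc k)"
    using consecutive_entries(2)[of k i l "Suc i" j] by (simp add: occurrences_def j)
  with left show ?thesis
    by (simp add: domino_bottoms_def j)
qed

lemma Suc_content_domino_top:
  assumes "x \<in> content lam ` domino_tops k" "Suc x \<in> residues lam T (Suc k)"
  shows "Suc x \<in> content lam ` domino_tops k"
proof -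
  obtain i j where ij: "(i, j) \<in> domino_bottoms k" "x = content lam (Suc i, j)"
    using assms(1) by (auto simp: domino_tops_def)
  then have "(i, Suc j) \<in> domino_bottoms k"
    using assms(2) domino_right[OF ij(1)] content_domino_bottom[OF ij(1)] by simp
  then have top: "(Suc i, Suc j) \<in> domino_tops k"
    by (auto simp: domino_tops_def)
  then have "(Suc i, Suc j) \<in> occurrences T (Suc k)"
    using dominoes_subset(2) by blast
  then have "content lam (Suc i, Suc j) = Suc x"
    using cell_bounds(1)[of "(Suc i, Suc j)" "Suc k"] by (simp add: ij(2) content_right)
  with top show ?thesis
    by (metis imageI)
qed

lemma content_domino_bottom_left:
  assumes "x \<in> content lam ` domino_tops k" "x \<in> residues lam T k"
  shows "x \<in> content lam ` domino_bottoms k"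
proof -
  obtain i j where ij: "(i, j) \<in> domino_bottoms k" "x = content lam (Suc i, j)"
    using assms(1) by (auto simp: domino_tops_def)
  then have "(i, j - 1) \<in> domino_bottoms k"
    using assms(2) domino_left[OF ij(1)] by simp
  moreover have "(i, j) \<in> occurrences T k"
    using ij(1) dominoes_subset(1) by blast
  then have "x = content lam (i, j - 1)"
    using ij(2) cell_bounds(2)[of "(i, j)" k] by (simp add: content_def)
  ultimately show ?thesis
    by blast
qed

definition content_bound :: nat where
  "content_bound = Suc (length lam + part lam 1)"

lemma residues_less_content_bound: "residues lam T a \<subseteq> {..<content_bound}"
proof -
  have "content lam c \<le> length lam + part lam 1" if "c \<in> occurrences T a" for c
    using cell_bounds[OF that] by (simp add: content_def)
  then show ?thesis
    by (auto simp: residues_def content_bound_def less_Suc_eq_le)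
qed

lemma finite_residues: "finite (residues lam T a)"
  using residues_less_content_bound finite_subset by blast

lemma content_Diff:
  "X \<subseteq> occurrences T a \<Longrightarrow>
    content lam ` (occurrences T a - X) = residues lam T a - content lam ` X"
  using inj_on_image_set_diff[OF inj_on_content[of a], of "occurrences T a" X]
  by (simp add: residues_def)

lemma content_lone_occurrences:
  "content lam ` lone_occurrences T k (Suc k) = residues lam T k - content lam ` domino_bottoms k
     - content lam ` (occurrences T k \<inter> occurrences T (Suc k))"
  "content lam ` lone_occurrences T (Suc k) k = residues lam T (Suc k) - content lam ` domino_tops k
     - content lam ` (occurrences T k \<inter> occurrences T (Suc k))"
proof -
  have "content lam ` (occurrences T a - X - Y) =
      residues lam T a - content lam ` X - content lam ` Y"
    if "X \<subseteq> occurrences T a" "Y \<subseteq> occurrences T a" for a X Y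
    using that inj_on_image_set_diff[OF inj_on_content[of a], of "occurrences T a - X" Y]
    by (auto simp: content_Diff)
  then show "content lam ` lone_occurrences T k (Suc k) =
      residues lam T k - content lam ` domino_bottoms k
        - content lam ` (occurrences T k \<inter> occurrences T (Suc k))"
    "content lam ` lone_occurrences T (Suc k) k =
      residues lam T (Suc k) - content lam ` domino_tops k
        - content lam ` (occurrences T k \<inter> occurrences T (Suc k))"
    unfolding lone_occurrences_eq by (simp_all add: dominoes_subset)
qed

lemma unpaired_residues_word:
  "unpaired (sign_word (residues lam T k) (residues lam T (Suc k)) [0..<content_bound]) =
   unpaired (sign_word (content lam ` lone_occurrences T k (Suc k))
       (content lam ` lone_occurrences T (Suc k) k) [0..<content_bound])"
  (is "unpaired (sign_word ?A ?B ?xs) = _")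
proof -
  let ?W = "content lam ` domino_tops k"
  let ?S = "content lam ` (occurrences T k \<inter> occurrences T (Suc k))"
  have "unpaired (sign_word ?A ?B ?xs) = unpaired (sign_word (?A - Suc ` ?W) (?B - ?W) ?xs)"
  proof (rule unpaired_sign_word_Diff_runs)
    show "?W \<subseteq> ?B" "Suc ` ?W \<subseteq> ?A"
      unfolding content_domino_bottoms[symmetric] residues_def
      by (intro image_mono dominoes_subset)+
    show "Suc x \<in> ?W" if "x \<in> ?W" "Suc x \<in> ?B" for x
      using that by (rule Suc_content_domino_top)
    show "x \<in> Suc ` ?W" if "x \<in> ?W" "x \<in> ?A" for x
      unfolding content_domino_bottoms[symmetric] using that by (rule content_domino_bottom_left)
  qed (rule residues_less_content_bound)
  also have "\<dots> = unpaired (sign_word (?A - Suc ` ?W - ?S) (?B - ?W - ?S) ?xs)"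
  proof (rule unpaired_sign_word_Diff_common)
    show "?S \<subseteq> (?A - Suc ` ?W) \<inter> (?B - ?W)"
      unfolding content_domino_bottoms[symmetric] content_Diff[OF dominoes_subset(1), symmetric]
        content_Diff[OF dominoes_subset(2), symmetric]
      using dominoes_disjoint by blast
  qed
  finally show ?thesis
    by (simp only: content_lone_occurrences content_domino_bottoms)
qed

definition column_content :: "nat \<Rightarrow> nat \<Rightarrow> nat" where
  "column_content k = content lam \<circ> inv_into (lone_cells k) snd"

lemma column_content_snd:
  "c \<in> lone_cells k \<Longrightarrow> column_content k (snd c) = content lam c"
  unfolding column_content_def comp_apply
  by (subst inv_into_f_f[OF inj_on_snd_if_total[OF totalp_on_lone_cells]]) simp_all

lemma content_image_eq_column_content:
  assumes "X \<subseteq> lone_cells k"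
  shows "content lam ` X = column_content k ` snd ` X"
proof (unfold image_image, rule image_cong[OF refl])
  fix c assume "c \<in> X"
  with assms have "c \<in> lone_cells k"
    by blast
  then show "content lam c = column_content k (snd c)"
    by (rule column_content_snd[symmetric])
qed

lemma strict_mono_on_column_content:
  "strict_mono_on (snd ` lone_cells k) (column_content k)"
proof (rule strict_mono_onI)
  fix i j assume "i \<in> snd ` lone_cells k" "j \<in> snd ` lone_cells k" "i < j"
  then obtain c d where cd: "c \<in> lone_cells k" "d \<in> lone_cells k" "i = snd c" "j = snd d"
    by blast
  then have "southeast c d"
    using totalp_onD[OF totalp_on_lone_cells cd(1,2)] \<open>i < j\<close> by (auto simp: southeast_def)
  moreover have "fst c \<le> length lam"
    using cd(1) cell_bounds(1)[of c] by (auto simp: lone_occurrences_def)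
  ultimately show "column_content k i < column_content k j"
    using cd content_less_if_southeast by (simp add: column_content_snd)
qed

lemma unpaired_residues_word_eq_signature:
  "unpaired (sign_word (residues lam T k) (residues lam T (Suc k)) [0..<content_bound]) =
   map (apsnd (column_content k)) (unpaired (signature lam k T))"
proof -
  let ?K = "lone_occurrences T k (Suc k)" and ?P = "lone_occurrences T (Suc k) k"
  have "sign_word (content lam ` ?K) (content lam ` ?P) [0..<content_bound] =
      map (apsnd (column_content k)) (signature lam k T)"
    unfolding signature_eq_sign_word
      content_image_eq_column_content[OF Un_upper1] content_image_eq_column_content[OF Un_upper2]
  proof (rule sign_word_image)
    show "strict_mono_on (snd ` ?K \<union> snd ` ?P) (column_content k)"
      using strict_mono_on_column_content by (simp add: image_Un)
    have "snd c \<in> set [1..<part lam 1 + 1]" if "c \<in> ?K \<union> ?P" for c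
      using that cell_bounds(2,3)[of c k] cell_bounds(2,3)[of c "Suc k"]
      by (auto simp: lone_occurrences_def less_Suc_eq_le)
    then show "snd ` ?K \<union> snd ` ?P \<subseteq> set [1..<part lam 1 + 1]"
      by blast
    show "sorted_wrt (<) [1..<part lam 1 + 1]" "sorted_wrt (<) [0..<content_bound]"
      by (rule sorted_wrt_upt)+
    have "column_content k ` (snd ` ?K \<union> snd ` ?P) = content lam ` (?K \<union> ?P)"
      using content_image_eq_column_content by (metis image_Un order_refl)
    also have "\<dots> \<subseteq> residues lam T k \<union> residues lam T (Suc k)"
      by (auto simp: residues_def lone_occurrences_def)
    also have "\<dots> \<subseteq> set [0..<content_bound]"
      using residues_less_content_bound by (auto simp only: atLeast_upt)
    finally show "column_content k ` (snd ` ?K \<union> snd ` ?P) \<subseteq> set [0..<content_bound]" .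
  qed
  then show ?thesis
    unfolding unpaired_residues_word by (simp only: unpaired_map_apsnd)
qed


subsection \<open>The crystal operators\<close>

definition unpaired_columns :: "sign \<Rightarrow> nat \<Rightarrow> nat set" where
  "unpaired_columns s k = {j. (s, j) \<in> set (unpaired (signature lam k T))}"

lemma unpaired_columns_subset:
  "unpaired_columns Minus k \<subseteq> snd ` lone_occurrences T k (Suc k)"
  "unpaired_columns Plus k \<subseteq> snd ` lone_occurrences T (Suc k) k"
  using set_unpaired_subset[of "signature lam k T"]
  by (auto simp: unpaired_columns_def signature_eq_sign_word set_sign_word)

lemma finite_unpaired_columns: "finite (unpaired_columns s k)"
  by (rule finite_subset[of _ "snd ` set (unpaired (signature lam k T))"])
    (force simp: unpaired_columns_def)+

lemma unpaired_letters:
  fixes k :: nat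
  defines "A \<equiv> residues lam T k" and "B \<equiv> residues lam T (Suc k)"
  shows "A - snd ` star_pairs (decreasing_word B) A = column_content k ` unpaired_columns Minus k"
    and "B - fst ` star_pairs (decreasing_word B) A = column_content k ` unpaired_columns Plus k"
proof -
  let ?p = "star_pairs (decreasing_word B) A"
  have "apsnd (column_content k) ` set (unpaired (signature lam k T)) =
      Pair Minus ` (A - snd ` ?p) \<union> Pair Plus ` (B - fst ` ?p)"
    unfolding set_map[symmetric] unpaired_residues_word_eq_signature[symmetric]
    using unpaired_sign_word_star_pairs[of "decreasing_word B" A content_bound]
      residues_less_content_bound
    by (simp only: A_def B_def set_decreasing_word finite_residues sorted_wrt_decreasing_word)
  then have "column_content k ` unpaired_columns s k =
      {x. (s, x) \<in> Pair Minus ` (A - snd ` ?p) \<union> Pair Plus ` (B - fst ` ?p)}" for s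
    unfolding unpaired_columns_def by (simp only: image_section_apsnd)
  moreover have "{x. (Minus, x) \<in> Pair Minus ` X \<union> Pair Plus ` Y} = X"
    "{x. (Plus, x) \<in> Pair Minus ` X \<union> Pair Plus ` Y} = Y" for X Y :: "nat set"
    by auto
  ultimately show "A - snd ` ?p = column_content k ` unpaired_columns Minus k"
    and "B - fst ` ?p = column_content k ` unpaired_columns Plus k"
    by (simp_all only:)
qed

lemma mono_on_column_content:
  "mono_on (unpaired_columns Minus k) (column_content k)"
  "mono_on (unpaired_columns Plus k) (column_content k)"
  by (rule strict_mono_on_imp_mono_on[OF monotone_on_subset[OF strict_mono_on_column_content]],
      use unpaired_columns_subset[of k] in blast)+

lemma last_unpaired_Minus:
  assumes "unpaired_columns Minus k \<noteq> {}"
  obtains i j where "(i, j) \<in> lone_occurrences T k (Suc k)" "j = Max (unpaired_columns Minus k)"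
    "Max (column_content k ` unpaired_columns Minus k) = content lam (i, j)"
proof -
  let ?j = "Max (unpaired_columns Minus k)"
  have "?j \<in> unpaired_columns Minus k"
    using finite_unpaired_columns assms by (rule Max_in)
  then obtain i where lone: "(i, ?j) \<in> lone_occurrences T k (Suc k)"
    using unpaired_columns_subset(1) by fastforce
  have "Max (column_content k ` unpaired_columns Minus k) = column_content k ?j"
    using mono_on_column_content(1) finite_unpaired_columns assms
    by (rule mono_on_Max_commute[symmetric])
  also have "\<dots> = content lam (i, ?j)"
    using column_content_snd[of "(i, ?j)" k] lone by simp
  finally show thesis
    using that lone by blast
qed

lemma first_unpaired_Plus:
  assumes "unpaired_columns Plus k \<noteq> {}"
  obtains i j where "(i, Suc j) \<in> lone_occurrences T (Suc k) k"
    "Suc j = Min (unpaired_columns Plus k)"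
    "Min (column_content k ` unpaired_columns Plus k) = content lam (i, Suc j)"
proof -
  let ?j = "Min (unpaired_columns Plus k)"
  have "?j \<in> unpaired_columns Plus k"
    using finite_unpaired_columns assms by (rule Min_in)
  then obtain i where lone: "(i, ?j) \<in> lone_occurrences T (Suc k) k"
    using unpaired_columns_subset(2) by fastforce
  then have "0 < ?j"
    using cell_bounds(2)[of "(i, ?j)" "Suc k"] by (simp add: lone_occurrences_def)
  then obtain j where j: "Suc j = ?j"
    by (metis Suc_pred)
  have "Min (column_content k ` unpaired_columns Plus k) = column_content k ?j"
    using mono_on_column_content(2) finite_unpaired_columns assms
    by (rule mono_on_Min_commute[symmetric])
  also have "\<dots> = content lam (i, ?j)"
    using column_content_snd[of "(i, ?j)" k] lone by simp
  finally show thesis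
    using that lone j by metis
qed

lemma svt_f_eq_move_entry:
  assumes "unpaired_columns Minus k \<noteq> {}" "(i, j) \<in> occurrences T k"
    and "j = Max (unpaired_columns Minus k)"
  shows "svt_f lam k T = Some (move_entry T
    (if (i, Suc j) \<in> occurrences T k \<inter> occurrences T (Suc k) then (i, Suc j) else (i, j)) k
    (i, j) (Suc k))"
  using assms(1) the_row[OF assms(2)]
  by (simp add: svt_f_def Let_def move_entry_def occurrences_def
      flip: unpaired_columns_def assms(3))

lemma svt_e_eq_move_entry:
  assumes "unpaired_columns Plus k \<noteq> {}" "(i, Suc j) \<in> occurrences T (Suc k)"
    and "Suc j = Min (unpaired_columns Plus k)"
  shows "svt_e lam k T = Some (move_entry T
    (if (i, j) \<in> occurrences T k \<inter> occurrences T (Suc k) then (i, j) else (i, Suc j)) (Suc k)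
    (i, Suc j) k)"
  using assms(1) the_row[OF assms(2)]
  by (simp add: svt_e_def Let_def move_entry_def occurrences_def
      flip: unpaired_columns_def assms(3))

lemma right_neighbour_iff:
  assumes "(i, j) \<in> lone_occurrences T k (Suc k)"
  shows "(i, Suc j) \<in> occurrences T k \<inter> occurrences T (Suc k) \<longleftrightarrow>
    Suc (content lam (i, j)) \<in> residues lam T k \<inter> residues lam T (Suc k)"
proof -
  have ij: "(i, j) \<in> occurrences T k"
    using assms by (simp add: lone_occurrences_def)
  then have "totalp_on (insert (i, j) (occurrences T k)) southeast"
    by (simp add: insert_absorb totalp_on_occurrences)
  then have "Suc (content lam (i, j)) \<in> residues lam T k \<longleftrightarrow> (i, Suc j) \<in> occurrences T k"
    unfolding residues_def using ij cell_bounds(1) by (intro Suc_content_mem_iff) auto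
  moreover have "Suc (content lam (i, j)) \<in> residues lam T (Suc k) \<longleftrightarrow>
      (i, Suc j) \<in> occurrences T (Suc k)"
    unfolding residues_def using totalp_on_insert_lone(1)[OF assms] ij cell_bounds(1)
    by (intro Suc_content_mem_iff) auto
  ultimately show ?thesis by blast
qed

lemma left_neighbour_iff:
  assumes "(i, Suc j) \<in> lone_occurrences T (Suc k) k"
  shows "(i, j) \<in> occurrences T k \<inter> occurrences T (Suc k) \<longleftrightarrow>
    content lam (i, Suc j) - 1 \<in> residues lam T k \<inter> residues lam T (Suc k)"
proof -
  have ij: "(i, Suc j) \<in> occurrences T (Suc k)"
    using assms by (simp add: lone_occurrences_def)
  then have "totalp_on (insert (i, Suc j) (occurrences T (Suc k))) southeast"
    by (simp add: insert_absorb totalp_on_occurrences)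
  then have "content lam (i, Suc j) - 1 \<in> residues lam T (Suc k) \<longleftrightarrow>
      (i, j) \<in> occurrences T (Suc k)"
    unfolding residues_def using ij cell_bounds(1) by (intro pred_content_mem_iff) auto
  moreover have "content lam (i, Suc j) - 1 \<in> residues lam T k \<longleftrightarrow> (i, j) \<in> occurrences T k"
    unfolding residues_def using totalp_on_insert_lone(2)[OF assms] ij cell_bounds(1)
    by (intro pred_content_mem_iff) auto
  ultimately show ?thesis by blast
qed

lemma star_f_res:
  assumes "1 \<le> k" "k < m"
  shows "star_f k (res m lam T) =
    (if unpaired_columns Minus k = {} then None
     else let x = Max (column_content k ` unpaired_columns Minus k);
              z = (if Suc x \<in> residues lam T k \<inter> residues lam T (Suc k) then Suc x else x) in
       Some (set_factor (set_factor (res m lam T) k (decreasing_word (residues lam T k - {z})))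
         (Suc k) (decreasing_word (insert x (residues lam T (Suc k))))))"
proof -
  have factors: "factor (res m lam T) k = decreasing_word (residues lam T k)"
    "factor (res m lam T) (Suc k) = decreasing_word (residues lam T (Suc k))"
    using assms by (simp_all add: factor_res)
  then show ?thesis
    unfolding star_f_def Let_def Suc_eq_plus1[symmetric]
    by (simp only: set_decreasing_word finite_residues unpaired_letters image_is_empty)
qed

lemma star_e_res:
  assumes "1 \<le> k" "k < m"
  shows "star_e k (res m lam T) =
    (if unpaired_columns Plus k = {} then None
     else let y = Min (column_content k ` unpaired_columns Plus k);
              z = (if y - 1 \<in> residues lam T k \<inter> residues lam T (Suc k) then y - 1 else y) in
       Some (set_factor
         (set_factor (res m lam T) (Suc k) (decreasing_word (residues lam T (Suc k) - {z})))
         k (decreasing_word (insert y (residues lam T k)))))"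
proof -
  have factors: "factor (res m lam T) k = decreasing_word (residues lam T k)"
    "factor (res m lam T) (Suc k) = decreasing_word (residues lam T (Suc k))"
    using assms by (simp_all add: factor_res)
  then show ?thesis
    unfolding star_e_def Let_def Suc_eq_plus1[symmetric]
    by (simp only: set_decreasing_word finite_residues unpaired_letters image_is_empty)
qed

lemma res_svt_f:
  assumes "1 \<le> k" "k < m"
  shows "map_option (res m lam) (svt_f lam k T) = star_f k (res m lam T)"
proof (cases "unpaired_columns Minus k = {}")
  case True
  then show ?thesis
    by (simp add: svt_f_def star_f_res[OF assms] flip: unpaired_columns_def)
next
  case False
  then obtain i j where lone: "(i, j) \<in> lone_occurrences T k (Suc k)"
    and j: "j = Max (unpaired_columns Minus k)"
    and Max: "Max (column_content k ` unpaired_columns Minus k) = content lam (i, j)"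
    by (rule last_unpaired_Minus)
  let ?A = "residues lam T k" and ?B = "residues lam T (Suc k)" and ?h = "res m lam T"
  let ?x = "content lam (i, j)"
  define d where
    "d = (if (i, Suc j) \<in> occurrences T k \<inter> occurrences T (Suc k) then (i, Suc j) else (i, j))"
  have ij: "(i, j) \<in> occurrences T k"
    using lone by (simp add: lone_occurrences_def)
  then have d: "d \<in> occurrences T k"
    by (simp add: d_def)
  have content_d: "content lam d = (if Suc ?x \<in> ?A \<inter> ?B then Suc ?x else ?x)"
    using right_neighbour_iff[OF lone] cell_bounds(1)[OF ij] by (simp add: d_def content_right)
  have "svt_f lam k T = Some (move_entry T d k (i, j) (Suc k))"
    unfolding d_def using False ij j by (rule svt_f_eq_move_entry)
  moreover have "star_f k ?h = Some (set_factor
      (set_factor ?h k (decreasing_word (?A - {content lam d})))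
      (Suc k) (decreasing_word (insert ?x ?B)))"
    using False by (simp add: star_f_res[OF assms] Let_def Max content_d)
  ultimately show ?thesis
    using assms d by (simp add: res_move_entry inj_on_content)
qed

lemma res_svt_e:
  assumes "1 \<le> k" "k < m"
  shows "map_option (res m lam) (svt_e lam k T) = star_e k (res m lam T)"
proof (cases "unpaired_columns Plus k = {}")
  case True
  then show ?thesis
    by (simp add: svt_e_def star_e_res[OF assms] flip: unpaired_columns_def)
next
  case False
  then obtain i j where lone: "(i, Suc j) \<in> lone_occurrences T (Suc k) k"
    and j: "Suc j = Min (unpaired_columns Plus k)"
    and Min: "Min (column_content k ` unpaired_columns Plus k) = content lam (i, Suc j)"
    by (rule first_unpaired_Plus)
  let ?A = "residues lam T k" and ?B = "residues lam T (Suc k)" and ?h = "res m lam T"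
  let ?y = "content lam (i, Suc j)"
  define d where
    "d = (if (i, j) \<in> occurrences T k \<inter> occurrences T (Suc k) then (i, j) else (i, Suc j))"
  have ij: "(i, Suc j) \<in> occurrences T (Suc k)"
    using lone by (simp add: lone_occurrences_def)
  then have d: "d \<in> occurrences T (Suc k)"
    by (simp add: d_def)
  have content_d: "content lam d = (if ?y - 1 \<in> ?A \<inter> ?B then ?y - 1 else ?y)"
    using left_neighbour_iff[OF lone] cell_bounds(1)[OF ij] by (simp add: d_def content_right)
  have "svt_e lam k T = Some (move_entry T d (Suc k) (i, Suc j) k)"
    unfolding d_def using False ij j by (rule svt_e_eq_move_entry)
  moreover have "star_e k ?h = Some (set_factor
      (set_factor ?h (Suc k) (decreasing_word (?B - {content lam d})))
      k (decreasing_word (insert ?y ?A)))"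
    using False by (simp add: star_e_res[OF assms] Let_def Min content_d)
  ultimately show ?thesis
    using assms d by (simp add: res_move_entry inj_on_content)
qed

end

theorem theorem2p17:
  fixes m k :: nat and lam mu :: "nat list" and T :: filling
  assumes "m \<ge> 2"
    and "is_partition lam" and "is_partition mu" and "partition_le mu lam"
    and "1 \<le> k" and "k < m"
    and "T \<in> SVT m lam mu"
  shows "map_option (res m lam) (svt_f lam k T) = star_f k (res m lam T)
    \<and> map_option (res m lam) (svt_e lam k T) = star_e k (res m lam T)
    \<and> (svt_f lam k T = None \<longleftrightarrow> star_f k (res m lam T) = None)
    \<and> (svt_e lam k T = None \<longleftrightarrow> star_e k (res m lam T) = None)"
proof -
  interpret set_valued_tableau m lam mu T
    using assms by unfold_locales
  show ?thesis
    using res_svt_f[OF \<open>1 \<le> k\<close> \<open>k < m\<close>] res_svt_e[OF \<open>1 \<le> k\<close> \<open>k < m\<close>]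
    by (metis option.map_disc_iff)
qed

end
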